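(* Let $E$ be a nonzero real Banach space, let $T : E^* \to E^{**}$ be a monotone linear map with $R(T) \subset \widehat{E}$, and define $S : E \rightrightarrows E^*$ by $x^* \in Sx \iff \widehat{x} = T x^*$. Then $S$ is maximally monotone and quasidense, and $S^{\mathbb F} = T$.
   Context: $\widehat{x}$ is the canonical image of $x \in E$ in $E^{**}$ and $\widehat{E} := \{\widehat{x} : x \in E\}$; $R(T)$ is the range of $T$. The linear map $T$ is monotone if $\langle x^*, Tx^*\rangle \ge 0$ for all $x^* \in E^*$; no continuity of $T$ is assumed. For a multifunction $S : E \rightrightarrows E^*$, $G(S) := \{(x,x^* ) : x^* \in Sx\}$ is its graph; $S$ is maximally monotone if $G(S)$ is a maximally monotone subset of $E \times E^*$, and quasidense if, for all $(x,x^* ) \in E \times E^*$, $\inf_{(s,s^* ) \in G(S)}\big[\frac12\|s-x\|^2 + \frac12\|s^*-x^*\|^2 + \langle s-x, s^*-x^*\rangle\big] \le 0$. For a closed (i.e. with norm-closed graph), quasidense, monotone $S : E \rightrightarrows E^*$, let $\varphi_S(x,x^* ) := \sup_{(s,s^* ) \in G(S)}[\langle s, x^*\rangle + \langle x, s^*\rangle - \langle s, s^*\rangle]$ and ${\varphi_S}^*(y^*,y^{**}) := \sup_{(x,x^* ) \in E \times E^*}[\langle x, y^*\rangle + \langle x^*, y^{**}\rangle - \varphi_S(x,x^* )]$; the Fitzpatrick extension $S^{\mathbb F} : E^* \rightrightarrows E^{**}$ is the multifunction with graph $G(S^{\mathbb F}) := \{(y^*,y^{**}) \in E^* \times E^{**}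 : {\varphi_S}^*(y^*,y^{**}) = \langle y^*, y^{**}\rangle\}$. The equality $S^{\mathbb F} = T$ means equality of graphs. *)

theory Defs
  imports "HOL-Analysis.Analysis"
begin

type_synonym 'a dual = "'a \<Rightarrow>\<^sub>L real"
type_synonym 'a bidual = "('a \<Rightarrow>\<^sub>L real) \<Rightarrow>\<^sub>L real"

lift_definition canon :: "'a::real_normed_vector \<Rightarrow> 'a bidual" is
  "\<lambda>x x'. blinfun_apply x' x"
  by (rule blinfun.bounded_linear_left)

text \<open>A multifunction from \<open>X\<close> to \<open>Y\<close> is a map into the subsets of \<open>Y\<close>.\<close>

definition graph :: "('x \<Rightarrow> 'y set) \<Rightarrow> ('x \<times> 'y) set" where
  "graph S = {(x, y). y \<in> S x}"

definition monotone_set :: "('a::real_normed_vector \<times> 'a dual) set \<Rightarrow> bool" where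
  "monotone_set A \<longleftrightarrow>
     (\<forall>(x, x') \<in> A. \<forall>(y, y') \<in> A. blinfun_apply (x' - y') (x - y) \<ge> 0)"

definition maximally_monotone_set :: "('a::real_normed_vector \<times> 'a dual) set \<Rightarrow> bool" where
  "maximally_monotone_set A \<longleftrightarrow>
     monotone_set A \<and> (\<forall>B. monotone_set B \<and> A \<subseteq> B \<longrightarrow> B = A)"

definition maximally_monotone :: "('a::real_normed_vector \<Rightarrow> 'a dual set) \<Rightarrow> bool" where
  "maximally_monotone S \<longleftrightarrow> maximally_monotone_set (graph S)"

text \<open>Infima and suprema are taken in the extended reals, so that the infimum over an
  empty graph is \<open>\<infinity>\<close> and \<open>fitzpatrick_fun\<close> may take the value \<open>\<infinity>\<close>.\<close>

definition quasidense :: "('a::real_normed_vector \<Rightarrow> 'a dual set) \<Rightarrow> bool" where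
  "quasidense S \<longleftrightarrow>
     (\<forall>x x'. (INF (s, s') \<in> graph S.
        ereal (1/2 * (norm (s - x))\<^sup>2 + 1/2 * (norm (s' - x'))\<^sup>2
               + blinfun_apply (s' - x') (s - x))) \<le> 0)"

definition fitzpatrick_fun ::
  "('a::real_normed_vector \<Rightarrow> 'a dual set) \<Rightarrow> 'a \<Rightarrow> 'a dual \<Rightarrow> ereal" where
  "fitzpatrick_fun S x x' =
     (SUP (s, s') \<in> graph S.
        ereal (blinfun_apply x' s + blinfun_apply s' x - blinfun_apply s' s))"

definition fitzpatrick_conj ::
  "('a::real_normed_vector \<Rightarrow> 'a dual set) \<Rightarrow> 'a dual \<Rightarrow> 'a bidual \<Rightarrow> ereal" where
  "fitzpatrick_conj S y' y'' =
     (SUP (x, x') \<in> UNIV.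
        ereal (blinfun_apply y' x + blinfun_apply y'' x') - fitzpatrick_fun S x x')"

text \<open>The Fitzpatrick extension is of interest for closed, quasidense, monotone \<open>S\<close>; the
  formula makes sense for every \<open>S\<close>, so it is stated as a total definition.\<close>

definition fitzpatrick_ext ::
  "('a::real_normed_vector \<Rightarrow> 'a dual set) \<Rightarrow> 'a dual \<Rightarrow> 'a bidual set" where
  "fitzpatrick_ext S y' =
     {y''. fitzpatrick_conj S y' y'' = ereal (blinfun_apply y'' y')}"

definition monotone_map :: "('a::real_normed_vector dual \<Rightarrow> 'a bidual) \<Rightarrow> bool" where
  "monotone_map T \<longleftrightarrow> (\<forall>x'. blinfun_apply (T x') x' \<ge> 0)"

end

theory Submission imports Defs begin

text \<open>
  Every value of \<open>T\<close> is \<open>\<widehat>A x'\<close> for a linear \<open>A : E\<^sup>* \<rightarrow> E\<close>, and the graph of \<open>S\<close>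
  consists of the pairs \<open>(A x', x')\<close>. Since \<open>A\<close> is defined on all of \<open>E\<^sup>*\<close>, one may move
  from a point \<open>y'\<close> in any direction \<open>h\<close> and stay in the domain. Maximality and the inclusion
  of \<open>G(S\<^sup>F)\<close> in \<open>G(T)\<close> both follow from this: the inequality in question, taken at
  \<open>y' + t h\<close>, has the form \<open>t \<alpha> \<le> t\<^sup>2 \<beta>\<close> for all real \<open>t\<close>, which forces \<open>\<alpha> = 0\<close>, and
  \<open>\<alpha> = 0\<close> for all \<open>h\<close> is the required equation. The reverse inclusion is a computation with
  the definition of the Fitzpatrick function.

  Quasidensity is the claim that
  \<open>\<parallel>Ah + c\<parallel>\<^sup>2/2 + \<parallel>h\<parallel>\<^sup>2/2 + \<langle>h, Ah + c\<rangle>\<close> has infimum at most \<open>0\<close> over \<open>h\<close>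
  (lemma \<open>monotone_approximate_solution\<close>). Treat \<open>w = Ah + c\<close> as a constraint on the pair
  \<open>(h, w)\<close>, with the convex objective \<open>\<parallel>w\<parallel>\<^sup>2/2 + \<parallel>h\<parallel>\<^sup>2/2 + \<langle>h, Ah + c\<rangle>\<close>.
  If the objective were at least \<open>m > 0\<close> under the constraint, there would be a Lagrange
  multiplier \<open>L \<in> E\<^sup>*\<close> with \<open>m + \<langle>L, w - Ah - c\<rangle>\<close> below the objective for all \<open>h\<close> and \<open>w\<close>.
  Minimising over \<open>w\<close> and substituting \<open>h = -L\<close> makes all terms cancel, whence \<open>m \<le> 0\<close>.
  The dual pairing is between \<open>E\<close> and \<open>E\<^sup>*\<close> because \<open>A\<close> has its values in \<open>E\<close>; this is why
  the multiplier lies in the domain of \<open>A\<close>, and it is where \<open>R(T) \<subseteq> \<widehat>E\<close> enters.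

  The multiplier comes from the Hahn-Banach theorem in its analytic form, every sublinear
  functional dominates a linear one, which is proved by taking a minimal sublinear
  functional. It also gives the injectivity of the canonical embedding.
\<close>

section \<open>Linear functionals below sublinear ones\<close>

text \<open>Only an inequality is asked of positive scalars: applied to \<open>t\<close> and to \<open>1/t\<close> it yields
  positive homogeneity, and the inequality is the easier condition to check for infima.\<close>

definition sublinear :: "('a::real_vector \<Rightarrow> real) \<Rightarrow> bool" where
  "sublinear p \<longleftrightarrow> (\<forall>x y. p (x + y) \<le> p x + p y) \<and> (\<forall>t>0. \<forall>x. p (t *\<^sub>R x) \<le> t * p x)"

lemma sublinear_add: "sublinear p \<Longrightarrow> p (x + y) \<le> p x + p y"
  by (simp add: sublinear_def)

lemma sublinear_zero:
  assumes "sublinear p" shows "p 0 = 0"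
proof -
  have "p (0 + 0) \<le> p 0 + p 0" using assms by (rule sublinear_add)
  moreover have "p ((1/2) *\<^sub>R 0) \<le> 1/2 * p 0"
    using assms unfolding sublinear_def by (meson half_gt_zero_iff zero_less_one)
  ultimately show ?thesis by simp
qed

lemma sublinear_scale:
  assumes "sublinear p" "t \<ge> 0" shows "p (t *\<^sub>R x) = t * p x"
proof (cases "t = 0")
  case True
  then show ?thesis using sublinear_zero[OF assms(1)] by simp
next
  case False
  then have t: "t > 0" using assms by simp
  have "p (t *\<^sub>R x) \<le> t * p x" using assms t by (simp add: sublinear_def)
  moreover have "p ((1/t) *\<^sub>R (t *\<^sub>R x)) \<le> 1/t * p (t *\<^sub>R x)"
    using assms(1) t unfolding sublinear_def by (meson zero_less_divide_1_iff)
  then have "t * p x \<le> p (t *\<^sub>R x)" using t by (simp add: field_simps)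
  ultimately show ?thesis by simp
qed

lemma sublinear_minus:
  assumes "sublinear p" shows "- p (- x) \<le> p x"
  using sublinear_add[OF assms, of x "- x"] sublinear_zero[OF assms] by simp

text \<open>The sublinear functionals needed below are all infima over sets \<open>K x\<close> of candidate
  values: over a chain of functionals, over the shifts of an argument, and over the
  representations of a vector as a multiple of a constraint value.\<close>

lemma sublinear_Inf:
  assumes ne: "\<And>x. K x \<noteq> {}" and bdd: "\<And>x. bdd_below (K x)"
    and add: "\<And>x y a b. a \<in> K x \<Longrightarrow> b \<in> K y \<Longrightarrow> \<exists>c\<in>K (x + y). c \<le> a + b"
    and scale: "\<And>x t a. t > 0 \<Longrightarrow> a \<in> K x \<Longrightarrow> \<exists>c\<in>K (t *\<^sub>R x). c \<le> t * a"
  shows "sublinear (\<lambda>x. Inf (K x))"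
  unfolding sublinear_def
proof (intro conjI allI impI)
  fix x y
  have *: "Inf (K (x + y)) \<le> a + b" if "a \<in> K x" "b \<in> K y" for a b
    using add[OF that] bdd by (meson cInf_lower order_trans)
  have "Inf (K (x + y)) - b \<le> Inf (K x)" if "b \<in> K y" for b
    using *[OF _ that] ne by (intro cInf_greatest) (auto simp: algebra_simps)
  then have "Inf (K (x + y)) - Inf (K x) \<le> Inf (K y)"
    using ne by (intro cInf_greatest) (auto simp: algebra_simps)
  then show "Inf (K (x + y)) \<le> Inf (K x) + Inf (K y)" by simp
next
  fix t :: real and x assume t: "t > 0"
  have "Inf (K (t *\<^sub>R x)) \<le> t * a" if "a \<in> K x" for a
    using scale[OF t that] bdd by (meson cInf_lower order_trans)
  then have "Inf (K (t *\<^sub>R x)) / t \<le> Inf (K x)"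
    using t ne by (intro cInf_greatest) (auto simp: field_simps)
  then show "Inf (K (t *\<^sub>R x)) \<le> t * Inf (K x)" using t by (simp add: field_simps)
qed

text \<open>The functional \<open>q x = inf\<^bsub>t \<ge> 0\<^esub> (p (x + t y) - t p y)\<close> does it: \<open>t = 0\<close> bounds
  it by \<open>p\<close>, and \<open>t = 1\<close> gives its value at \<open>- y\<close>. Thus a functional minimal among the sublinear
  ones is odd.\<close>

lemma sublinear_tilt:
  assumes p: "sublinear p"
  obtains q where "sublinear q" "\<And>x. q x \<le> p x" "q (- y) \<le> - p y"
proof -
  define K where "K = (\<lambda>x. {p (x + t *\<^sub>R y) - t * p y | t. t \<ge> 0})"
  have mem: "p (x + t *\<^sub>R y) - t * p y \<in> K x" if "t \<ge> 0" for x t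
    using that by (auto simp: K_def)
  have bdd: "bdd_below (K x)" for x
  proof (rule bdd_belowI)
    fix a assume "a \<in> K x"
    then obtain t where t: "t \<ge> 0" and a: "a = p (x + t *\<^sub>R y) - t * p y"
      by (auto simp: K_def)
    have "p ((x + t *\<^sub>R y) + - x) \<le> p (x + t *\<^sub>R y) + p (- x)"
      using p by (rule sublinear_add)
    then show "- p (- x) \<le> a" using a sublinear_scale[OF p t] by simp
  qed
  have "sublinear (\<lambda>x. Inf (K x))"
  proof (rule sublinear_Inf)
    show "K x \<noteq> {}" for x using mem[of 0] by blast
    show "bdd_below (K x)" for x by (rule bdd)
    fix x z a b assume "a \<in> K x" "b \<in> K z"
    then obtain t s where ts: "t \<ge> 0" "s \<ge> 0" "a = p (x + t *\<^sub>R y) - t * p y"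
      "b = p (z + s *\<^sub>R y) - s * p y" by (auto simp: K_def)
    have "p ((x + z) + (t + s) *\<^sub>R y) \<le> p (x + t *\<^sub>R y) + p (z + s *\<^sub>R y)"
      using sublinear_add[OF p, of "x + t *\<^sub>R y" "z + s *\<^sub>R y"] by (simp add: algebra_simps)
    then show "\<exists>c\<in>K (x + z). c \<le> a + b"
      using ts by (intro bexI[OF _ mem[of "t + s"]]) (auto simp: algebra_simps)
  next
    fix x t a assume t: "(t::real) > 0" and "a \<in> K x"
    then obtain s where s: "s \<ge> 0" "a = p (x + s *\<^sub>R y) - s * p y" by (auto simp: K_def)
    have "p (t *\<^sub>R x + (t * s) *\<^sub>R y) = t * p (x + s *\<^sub>R y)"
      using sublinear_scale[OF p, of t "x + s *\<^sub>R y"] t by (simp add: algebra_simps)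
    then show "\<exists>c\<in>K (t *\<^sub>R x). c \<le> t * a"
      using t s by (intro bexI[OF _ mem[of "t * s"]]) (auto simp: right_diff_distrib)
  qed
  moreover have "Inf (K x) \<le> p x" for x
    using cInf_lower[OF mem[of 0 x] bdd] by simp
  moreover have "Inf (K (- y)) \<le> - p y"
    using cInf_lower[OF mem[of 1 "- y"] bdd] sublinear_zero[OF p] by simp
  ultimately show ?thesis using that by blast
qed

text \<open>Zorn's lemma applies because all sublinear functionals \<open>q \<le> p\<close> share the lower bound
  \<open>- p (- x) \<le> q x\<close>, so the infimum of a chain is finite. A minimal one is odd by
  \<open>sublinear_tilt\<close>, and an odd sublinear functional is linear.\<close>

theorem sublinear_dominates_linear:
  assumes p: "sublinear p"
  obtains L where "linear L" "\<And>x. L x \<le> p x"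
proof -
  define A where "A = {q. sublinear q \<and> (\<forall>x. q x \<le> p x)}"
  have "\<exists>m\<in>A. \<forall>a\<in>A. a \<le> m \<longrightarrow> a = m"
  proof (rule predicate_Zorn)
    show "partial_order_on A (relation_of (\<lambda>x y. y \<le> x) A)"
      by (rule partial_order_on_relation_ofI) auto
  next
    fix C assume C: "C \<in> Chains (relation_of (\<lambda>x y. y \<le> x) A)"
    then have CA: "C \<subseteq> A" and tot: "\<And>a b. a \<in> C \<Longrightarrow> b \<in> C \<Longrightarrow> a \<le> b \<or> b \<le> a"
      by (auto simp: Chains_def relation_of_def)
    show "\<exists>u\<in>A. \<forall>a\<in>C. u \<le> a"
    proof (cases "C = {}")
      case True
      then show ?thesis using p by (auto simp: A_def)
    next
      case False
      define K where "K = (\<lambda>x. (\<lambda>q. q x) ` C)"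
      have bdd: "bdd_below (K x)" for x
      proof (rule bdd_belowI)
        fix a assume "a \<in> K x"
        then obtain q where q: "q \<in> A" "a = q x" using CA by (auto simp: K_def)
        then have "- p (- x) \<le> - q (- x)" by (simp add: A_def)
        also have "\<dots> \<le> q x" using q by (intro sublinear_minus) (simp add: A_def)
        finally show "- p (- x) \<le> a" using q by simp
      qed
      have sub: "sublinear (\<lambda>x. Inf (K x))"
      proof (rule sublinear_Inf)
        show "K x \<noteq> {}" for x using False by (simp add: K_def)
        show "bdd_below (K x)" for x by (rule bdd)
        fix x y a b assume "a \<in> K x" "b \<in> K y"
        then obtain q r where qr: "q \<in> C" "a = q x" "r \<in> C" "b = r y" by (auto simp: K_def)
        then obtain u where u: "u \<in> C" "u \<le> q" "u \<le> r" using tot by blast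
        then have "u (x + y) \<le> u x + u y" using CA by (auto simp: A_def sublinear_add)
        also have "\<dots> \<le> a + b" using u qr by (auto simp: le_fun_def intro: add_mono)
        finally show "\<exists>c\<in>K (x + y). c \<le> a + b" using u by (auto simp: K_def)
      next
        fix x t a assume "(t::real) > 0" "a \<in> K x"
        then show "\<exists>c\<in>K (t *\<^sub>R x). c \<le> t * a"
          using CA by (fastforce simp: K_def A_def sublinear_def)
      qed
      have le: "Inf (K x) \<le> q x" if "q \<in> C" for q x
        using that bdd by (auto simp: K_def intro: cInf_lower)
      obtain q where "q \<in> C" using False by blast
      then have "Inf (K x) \<le> p x" for x
        using le[of q x] CA by (auto simp: A_def intro: order_trans)
      then show ?thesis using sub le by (intro bexI[of _ "\<lambda>x. Inf (K x)"]) (auto simp: A_def le_fun_def)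
    qed
  qed
  then obtain m where mA: "m \<in> A" and minA: "\<And>q. q \<in> A \<Longrightarrow> q \<le> m \<Longrightarrow> q = m" by blast
  have m: "sublinear m" "\<And>x. m x \<le> p x" using mA by (auto simp: A_def)
  have min: "q = m" if "sublinear q" "\<And>x. q x \<le> m x" for q
  proof (rule minA)
    show "q \<in> A" using that m(2) by (auto simp: A_def intro: order_trans)
    show "q \<le> m" using that by (simp add: le_fun_def)
  qed
  have "m (- y) \<le> - m y" for y
    using sublinear_tilt[OF m(1), of y] min by metis
  then have odd: "m (- y) = - m y" for y
    using sublinear_minus[OF m(1), of y] by (simp add: order.antisym)
  have "linear m"
  proof (rule linearI)
    fix x y
    have "m x \<le> m (x + y) + m (- y)"
      using sublinear_add[OF m(1), of "x + y" "- y"] by simp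
    then show "m (x + y) = m x + m y"
      using sublinear_add[OF m(1), of x y] odd by simp
  next
    fix t x
    show "m (t *\<^sub>R x) = t *\<^sub>R m x"
    proof (cases "t \<ge> 0")
      case True
      then show ?thesis using sublinear_scale[OF m(1)] by simp
    next
      case False
      then have "m ((- t) *\<^sub>R x) = - t * m x" by (intro sublinear_scale[OF m(1)]) simp
      then show ?thesis using odd[of "t *\<^sub>R x"] by simp
    qed
  qed
  then show ?thesis using m that by blast
qed

text \<open>Tilting \<open>p\<close> towards \<open>y\<close> before choosing the linear functional makes the bound an equality
  at \<open>y\<close>.\<close>

corollary sublinear_support:
  assumes p: "sublinear p"
  obtains L where "linear L" "\<And>x. L x \<le> p x" "L y = p y"
proof -
  obtain q where q: "sublinear q" "\<And>x. q x \<le> p x" "q (- y) \<le> - p y"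
    using sublinear_tilt[OF p] by blast
  obtain L where L: "linear L" "\<And>x. L x \<le> q x"
    using sublinear_dominates_linear[OF q(1)] by blast
  have "- L y \<le> - p y" using L(2)[of "- y"] q(3) linear_neg[OF L(1), of y] by simp
  moreover have le: "L x \<le> p x" for x using L(2) q(2) order_trans by blast
  ultimately show ?thesis using that[OF L(1) le] le[of y] by simp
qed

lemma linear_bounded_above_imp_blinfun:
  fixes L :: "'a::real_normed_vector \<Rightarrow> real"
  assumes L: "linear L" and bound: "\<And>x. norm x \<le> 1 \<Longrightarrow> L x \<le> B"
  obtains f where "\<And>x. blinfun_apply f x = L x"
proof -
  have le: "L x \<le> norm x * B" for x
  proof (cases "x = 0")
    case True
    then show ?thesis using linear_0[OF L] by simp
  next
    case False
    then have "L ((1 / norm x) *\<^sub>R x) \<le> B" by (intro bound) simp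
    then show ?thesis using False by (simp add: linear_scale[OF L] field_simps)
  qed
  have "bounded_linear L"
  proof (rule bounded_linear_intro)
    show "L (x + y) = L x + L y" for x y by (rule linear_add[OF L])
    show "L (r *\<^sub>R x) = r *\<^sub>R L x" for r x by (rule linear_scale[OF L])
    show "norm (L x) \<le> norm x * B" for x
      using le[of x] le[of "- x"] linear_neg[OF L, of x] by (simp add: abs_le_iff)
  qed
  then show ?thesis using that[of "Blinfun L"] by (simp add: bounded_linear_Blinfun_apply)
qed

lemma norming_functional:
  fixes x :: "'a::real_normed_vector"
  obtains f :: "'a dual" where "blinfun_apply f x = norm x"
proof -
  have "sublinear (norm :: 'a \<Rightarrow> real)" by (simp add: sublinear_def norm_triangle_ineq)
  then obtain L where L: "linear L" "\<And>y. L y \<le> norm (y::'a)" "L x = norm x"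
    using sublinear_support by blast
  obtain f where f: "\<And>y. blinfun_apply f y = L y"
    using linear_bounded_above_imp_blinfun[OF L(1), of 1] L(2) order_trans by blast
  show ?thesis by (rule that[of f]) (simp add: f L(3))
qed

section \<open>Lagrange multipliers for affine constraints\<close>

text \<open>The multiplier is a linear functional below
  \<open>q e = inf {t (\<Phi> z - m) | t > 0 \<and> t (B z + d) = e}\<close>, the optimal value of
  the constraint perturbed by \<open>e\<close>, made positively homogeneous. Surjectivity of \<open>B\<close>
  makes \<open>q\<close> finite: a \<open>z\<^sub>0\<close> with \<open>B z\<^sub>0 + d = - e\<close> combines with \<open>z\<close> to a feasible point, where \<open>\<Phi>\<close> is at least \<open>m\<close>.\<close>

lemma lagrange_multiplier:
  fixes B :: "'z::real_vector \<Rightarrow> 'e::real_vector" and \<Phi> :: "'z \<Rightarrow> real"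
  assumes conv: "convex_on UNIV \<Phi>" and B: "linear B" and surj: "surj B"
    and bound: "\<And>z. B z + d = 0 \<Longrightarrow> m \<le> \<Phi> z"
  obtains L where "linear L" "\<And>z. m + L (B z + d) \<le> \<Phi> z"
proof -
  define K where "K = (\<lambda>e. {t * (\<Phi> z - m) | t z. t > 0 \<and> t *\<^sub>R (B z + d) = e})"
  have mem: "t * (\<Phi> z - m) \<in> K e" if "t > 0" "t *\<^sub>R (B z + d) = e" for t z e
    using that by (auto simp: K_def)
  have onto: "\<exists>z. B z + d = e" for e
    using surjD[OF surj, of "e - d"] by (metis diff_add_cancel)
  have combine: "\<exists>z. (t + s) *\<^sub>R (B z + d) = t *\<^sub>R (B z1 + d) + s *\<^sub>R (B z2 + d)
      \<and> (t + s) * (\<Phi> z - m) \<le> t * (\<Phi> z1 - m) + s * (\<Phi> z2 - m)"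
    if ts: "t > 0" "s > 0" for t s z1 z2
  proof -
    define z where "z = (t / (t + s)) *\<^sub>R z1 + (s / (t + s)) *\<^sub>R z2"
    have one: "t / (t + s) + s / (t + s) = 1" using ts by (simp flip: add_divide_distrib)
    have "\<Phi> z \<le> t / (t + s) * \<Phi> z1 + s / (t + s) * \<Phi> z2"
      unfolding z_def using conv one ts unfolding convex_on_def
      by (meson UNIV_I add_nonneg_nonneg divide_nonneg_nonneg less_imp_le)
    then have "\<Phi> z \<le> (t * \<Phi> z1 + s * \<Phi> z2) / (t + s)"
      by (simp add: add_divide_distrib)
    then have "(t + s) * \<Phi> z \<le> t * \<Phi> z1 + s * \<Phi> z2"
      using ts by (simp add: pos_le_divide_eq mult.commute)
    moreover have "(t + s) *\<^sub>R B z = t *\<^sub>R B z1 + s *\<^sub>R B z2"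
      using ts by (simp add: z_def linear_add[OF B] linear_scale[OF B] scaleR_add_right)
    ultimately show ?thesis by (intro exI[of _ z]) (simp add: algebra_simps)
  qed
  have bdd: "bdd_below (K e)" for e
  proof -
    obtain z0 where z0: "B z0 + d = - e" using onto by blast
    show ?thesis
    proof (rule bdd_belowI)
      fix a assume "a \<in> K e"
      then obtain t z where tz: "t > 0" "t *\<^sub>R (B z + d) = e" "a = t * (\<Phi> z - m)"
        by (auto simp: K_def)
      obtain w where w: "(t + 1) *\<^sub>R (B w + d) = t *\<^sub>R (B z + d) + 1 *\<^sub>R (B z0 + d)"
        "(t + 1) * (\<Phi> w - m) \<le> t * (\<Phi> z - m) + 1 * (\<Phi> z0 - m)"
        using combine[OF tz(1) zero_less_one, of z z0] by blast
      have "B w + d = 0" using w(1) tz z0 by simp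
      then have "0 \<le> (t + 1) * (\<Phi> w - m)" using bound tz by simp
      then show "- (\<Phi> z0 - m) \<le> a" using w(2) unfolding tz(3) by simp
    qed
  qed
  have "sublinear (\<lambda>e. Inf (K e))"
  proof (rule sublinear_Inf)
    show "K e \<noteq> {}" for e
    proof -
      obtain z where "B z + d = e" using onto by blast
      then show ?thesis using mem[of 1 z e] by auto
    qed
    show "bdd_below (K e)" for e by (rule bdd)
    fix x y a b assume "a \<in> K x" "b \<in> K y"
    then obtain t z1 s z2 where *: "t > 0" "t *\<^sub>R (B z1 + d) = x" "a = t * (\<Phi> z1 - m)"
      "s > 0" "s *\<^sub>R (B z2 + d) = y" "b = s * (\<Phi> z2 - m)" by (auto simp: K_def)
    obtain z where "(t + s) *\<^sub>R (B z + d) = x + y" "(t + s) * (\<Phi> z - m) \<le> a + b"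
      using combine[of t s z1 z2] * by auto
    then show "\<exists>c\<in>K (x + y). c \<le> a + b"
      using * by (intro bexI[OF _ mem[of "t + s" z]]) auto
  next
    fix x t a assume t: "(t::real) > 0" and "a \<in> K x"
    then obtain s z where s: "s > 0" "s *\<^sub>R (B z + d) = x" "a = s * (\<Phi> z - m)"
      by (auto simp: K_def)
    then show "\<exists>c\<in>K (t *\<^sub>R x). c \<le> t * a"
      using t by (intro bexI[OF _ mem[of "t * s" z]]) auto
  qed
  then obtain L where L: "linear L" "\<And>e. L e \<le> Inf (K e)"
    using sublinear_dominates_linear by blast
  have "L (B z + d) \<le> \<Phi> z - m" for z
    using L(2)[of "B z + d"] cInf_lower[OF mem[of 1 z "B z + d"] bdd] by simp
  then have "m + L (B z + d) \<le> \<Phi> z" for z by (metis add.commute le_diff_eq)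
  then show ?thesis using that L(1) by blast
qed

section \<open>Monotone linear maps from the dual into the space\<close>

lemma convex_on_half_norm_square:
  "convex_on UNIV (\<lambda>x::'a::real_normed_vector. 1/2 * (norm x)\<^sup>2)"
proof (rule convex_onI)
  fix t :: real and x y :: 'a assume t: "0 < t" "t < 1"
  have "norm ((1 - t) *\<^sub>R x + t *\<^sub>R y) \<le> (1 - t) * norm x + t * norm y"
    using norm_triangle_ineq[of "(1 - t) *\<^sub>R x" "t *\<^sub>R y"] t by simp
  then have "(norm ((1 - t) *\<^sub>R x + t *\<^sub>R y))\<^sup>2 \<le> ((1 - t) * norm x + t * norm y)\<^sup>2"
    by (simp add: power_mono)
  also have "\<dots> \<le> (1 - t) * (norm x)\<^sup>2 + t * (norm y)\<^sup>2"
    using convex_onD[OF convex_power2, of t "norm x" "norm y"] t by simp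
  finally show "1/2 * (norm ((1 - t) *\<^sub>R x + t *\<^sub>R y))\<^sup>2
      \<le> (1 - t) * (1/2 * (norm x)\<^sup>2) + t * (1/2 * (norm y)\<^sup>2)" by simp
qed simp

lemma convex_on_monotone_form:
  fixes A :: "'a::real_normed_vector dual \<Rightarrow> 'a"
  assumes A: "linear A" and mono: "\<And>h. 0 \<le> blinfun_apply h (A h)"
  shows "convex_on UNIV (\<lambda>h. blinfun_apply h (A h + c))"
proof (rule convex_onI)
  fix t :: real and h k :: "'a dual" assume t: "0 < t" "t < 1"
  have "0 \<le> t * (1 - t) * blinfun_apply (h - k) (A (h - k))"
    using t mono[of "h - k"] by simp
  then show "blinfun_apply ((1 - t) *\<^sub>R h + t *\<^sub>R k) (A ((1 - t) *\<^sub>R h + t *\<^sub>R k) + c)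
      \<le> (1 - t) * blinfun_apply h (A h + c) + t * blinfun_apply k (A k + c)"
    by (simp add: linear_add[OF A] linear_scale[OF A] linear_diff[OF A] blinfun.add_left
        blinfun.add_right blinfun.diff_left blinfun.diff_right blinfun.scaleR_left
        blinfun.scaleR_right algebra_simps)
qed simp

text \<open>\<open>\<parallel>p\<parallel>\<^sup>2/2\<close> is the conjugate of \<open>\<parallel>w\<parallel>\<^sup>2/2\<close>. The operator norm need not be attained,
  so there may be no \<open>w\<close> that gives the inequality at once; instead, testing the bound \<open>M\<close> with
  all multiples of a given \<open>w\<close> gives \<open>|p w| \<le> \<surd>(2M) \<parallel>w\<parallel>\<close>.\<close>

lemma half_norm_square_le_conjugate:
  fixes p :: "'a::real_normed_vector dual"
  assumes le: "\<And>w. blinfun_apply p w - 1/2 * (norm w)\<^sup>2 \<le> M"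
  shows "1/2 * (norm p)\<^sup>2 \<le> M"
proof -
  have M: "0 \<le> M" using le[of 0] by (simp add: blinfun.zero_right)
  have "norm p \<le> sqrt (2 * M)"
  proof (rule norm_blinfun_bound)
    fix w
    show "norm (blinfun_apply p w) \<le> sqrt (2 * M) * norm w"
    proof (cases "w = 0")
      case True
      then show ?thesis by (simp add: blinfun.zero_right)
    next
      case False
      \<comment> \<open>\<open>t = p w / \<parallel>w\<parallel>\<^sup>2\<close> maximises \<open>p (t w) - \<parallel>t w\<parallel>\<^sup>2/2\<close>, with value \<open>(p w)\<^sup>2 / (2 \<parallel>w\<parallel>\<^sup>2)\<close>.\<close>
      define t where "t = blinfun_apply p w / (norm w)\<^sup>2"
      have "(blinfun_apply p w)\<^sup>2 / (2 * (norm w)\<^sup>2)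
          = t * blinfun_apply p w - 1/2 * (t\<^sup>2 * (norm w)\<^sup>2)"
        using False by (simp add: t_def field_simps power2_eq_square)
      also have "\<dots> \<le> M"
        using le[of "t *\<^sub>R w"] by (simp add: blinfun.scaleR_right power_mult_distrib)
      finally have "(blinfun_apply p w)\<^sup>2 \<le> 2 * M * (norm w)\<^sup>2"
        using False by (simp add: field_simps)
      then have "sqrt ((blinfun_apply p w)\<^sup>2) \<le> sqrt (2 * M * (norm w)\<^sup>2)"
        by (rule real_sqrt_le_mono)
      then show ?thesis by (simp add: real_sqrt_mult)
    qed
  qed (simp add: M)
  then have "(norm p)\<^sup>2 \<le> (sqrt (2 * M))\<^sup>2" by (simp add: power_mono)
  then show ?thesis using M by simp
qed

text \<open>The left-hand side is \<open>\<parallel>w\<parallel>\<^sup>2/2 + \<parallel>h\<parallel>\<^sup>2/2 - \<langle>-h, w\<rangle>\<close> with \<open>w = Ah + c\<close>, the gap in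
  Young's inequality for \<open>w\<close> and \<open>-h\<close>; that it is small says that \<open>h\<close> almost solves the
  inclusion \<open>-h \<in> J (Ah + c)\<close> with the duality map \<open>J\<close> of \<open>E\<close>. A lower
  bound \<open>m > 0\<close> is refuted by its own Lagrange multiplier.\<close>

lemma monotone_approximate_solution:
  fixes A :: "'a::real_normed_vector dual \<Rightarrow> 'a"
  assumes A: "linear A" and mono: "\<And>h. 0 \<le> blinfun_apply h (A h)" and m: "m > 0"
  shows "\<exists>h. 1/2 * (norm (A h + c))\<^sup>2 + 1/2 * (norm h)\<^sup>2 + blinfun_apply h (A h + c) < m"
proof (rule ccontr)
  assume "\<not> ?thesis"
  then have lower: "m \<le> 1/2 * (norm (A h + c))\<^sup>2 + 1/2 * (norm h)\<^sup>2 + blinfun_apply h (A h + c)"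
    for h by (meson not_less)
  define \<Phi> where "\<Phi> = (\<lambda>(h, w :: 'a). 1/2 * (norm w)\<^sup>2 + 1/2 * (norm h)\<^sup>2 + blinfun_apply h (A h + c))"
  define B where "B = (\<lambda>(h, w). w - A h)"
  have "convex_on UNIV \<Phi>"
  proof (rule convex_onI)
    fix t :: real and y z :: "'a dual \<times> 'a" assume t: "0 < t" "t < 1"
    obtain h w k v where yz: "y = (h, w)" "z = (k, v)" by (cases y, cases z)
    show "\<Phi> ((1 - t) *\<^sub>R y + t *\<^sub>R z) \<le> (1 - t) * \<Phi> y + t * \<Phi> z"
      using t convex_onD[OF convex_on_half_norm_square, of t h k]
        convex_onD[OF convex_on_half_norm_square, of t w v]
        convex_onD[OF convex_on_monotone_form[OF A mono, of c], of t h k]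
      by (simp add: \<Phi>_def yz distrib_left)
  qed simp
  moreover have "linear B"
    by (rule linearI) (auto simp: B_def linear_add[OF A] linear_scale[OF A] algebra_simps)
  moreover have "surj B"
    by (rule surjI[of _ "\<lambda>e. (0, e)"]) (simp add: B_def linear_0[OF A])
  moreover have "m \<le> \<Phi> z" if "B z + (- c) = 0" for z
  proof -
    obtain h w where z: "z = (h, w)" by (cases z)
    then have "w = A h + c" using that by (simp add: B_def algebra_simps)
    then show ?thesis using lower[of h] by (simp add: \<Phi>_def z)
  qed
  ultimately obtain L where L: "linear L" "\<And>z. m + L (B z + (- c)) \<le> \<Phi> z"
    using lagrange_multiplier by blast
  have mult: "m + L (w - A h - c) \<le> 1/2 * (norm w)\<^sup>2 + 1/2 * (norm h)\<^sup>2 + blinfun_apply h (A h + c)"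
    for h w using L(2)[of "(h, w)"] by (simp add: \<Phi>_def B_def)
  have "L e \<le> 1/2 * (1 + norm c)\<^sup>2" if "norm e \<le> 1" for e
  proof -
    have "L e \<le> 1/2 * (norm (e + c))\<^sup>2"
      using mult[of "e + c" 0] m by (simp add: linear_0[OF A] blinfun.zero_left)
    moreover have "norm (e + c) \<le> 1 + norm c" using norm_triangle_ineq[of e c] that by linarith
    then have "(norm (e + c))\<^sup>2 \<le> (1 + norm c)\<^sup>2" by (rule power_mono) simp
    ultimately show ?thesis by linarith
  qed
  then obtain p where p: "\<And>x. blinfun_apply p x = L x"
    using linear_bounded_above_imp_blinfun[OF L(1)] by blast
  have "blinfun_apply p w - 1/2 * (norm w)\<^sup>2 \<le> 1/2 * (norm p)\<^sup>2 - m" for w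
    using mult[of w "- p"]
    by (simp add: linear_neg[OF A] blinfun.minus_left blinfun.minus_right blinfun.add_right
        blinfun.diff_right flip: p)
  then have "1/2 * (norm p)\<^sup>2 \<le> 1/2 * (norm p)\<^sup>2 - m" by (rule half_norm_square_le_conjugate)
  then show False using m by simp
qed

section \<open>The canonical embedding\<close>

lemma canon_apply [simp]: "blinfun_apply (canon x) x' = blinfun_apply x' x"
  by transfer simp

lemma linear_canon: "linear canon"
  by (rule linearI) (auto intro!: blinfun_eqI simp: blinfun.add_left blinfun.add_right
      blinfun.scaleR_left blinfun.scaleR_right)

lemma inj_canon: "inj (canon :: 'a::real_normed_vector \<Rightarrow> 'a bidual)"
proof (rule injI)
  fix x y :: 'a assume eq: "canon x = canon y"
  obtain f :: "'a dual" where "blinfun_apply f (x - y) = norm (x - y)"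
    by (rule norming_functional)
  moreover have "blinfun_apply f x = blinfun_apply f y" using eq canon_apply by metis
  ultimately show "x = y" by (simp add: blinfun.diff_right)
qed

text \<open>For small \<open>t\<close> of either sign the quadratic term is negligible.\<close>

lemma linear_le_quadratic_imp_zero:
  fixes a b :: real
  assumes "\<And>t. t * a \<le> t\<^sup>2 * b"
  shows "a = 0"
proof (rule ccontr)
  assume "a \<noteq> 0"
  \<comment> \<open>The denominator exceeds \<open>b\<close>, so \<open>t\<^sup>2 b < t a\<close> at \<open>t = a / (|b| + 1)\<close>.\<close>
  define k where "k = \<bar>b\<bar> + 1"
  have k: "k > 0" "b < k" by (auto simp: k_def)
  have "a\<^sup>2 * k \<le> a\<^sup>2 * b"
    using assms[of "a / k"] k by (simp add: field_simps power2_eq_square)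
  moreover have "a\<^sup>2 * b < a\<^sup>2 * k" using \<open>a \<noteq> 0\<close> k by simp
  ultimately show False by simp
qed

section \<open>The inverse of a monotone linear map\<close>

context
  fixes A :: "'a::real_normed_vector dual \<Rightarrow> 'a" and S :: "'a \<Rightarrow> 'a dual set"
  assumes A: "linear A" and mono: "\<And>h. 0 \<le> blinfun_apply h (A h)"
    and S: "\<And>x x'. x' \<in> S x \<longleftrightarrow> x = A x'"
begin

lemma graph_S: "graph S = range (\<lambda>h. (A h, h))"
  by (auto simp: graph_def S)

text \<open>If \<open>(y, y')\<close> is monotonically related to the graph, comparing it with the points over
  \<open>y' + t h\<close> gives \<open>y = A y'\<close>: no functional \<open>h\<close> separates the two.\<close>

lemma maximally_monotone_inverse: "maximally_monotone S"
  unfolding maximally_monotone_def maximally_monotone_set_def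
proof (intro conjI allI impI)
  show "monotone_set (graph S)"
    using mono by (auto simp: monotone_set_def graph_S simp flip: linear_diff[OF A])
next
  fix C assume "monotone_set C \<and> graph S \<subseteq> C"
  then have C: "monotone_set C" and sub: "graph S \<subseteq> C" by auto
  have "(y, y') \<in> graph S" if y: "(y, y') \<in> C" for y y'
  proof -
    have "blinfun_apply h (y - A y') = 0" for h :: "'a dual"
    proof (rule linear_le_quadratic_imp_zero)
      fix t
      have "(A (y' + t *\<^sub>R h), y' + t *\<^sub>R h) \<in> C" using sub by (auto simp: graph_S)
      then have "0 \<le> blinfun_apply (y' - (y' + t *\<^sub>R h)) (y - A (y' + t *\<^sub>R h))"
        using C y unfolding monotone_set_def by blast
      then show "t * blinfun_apply h (y - A y') \<le> t\<^sup>2 * blinfun_apply h (A h)"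
        by (simp add: linear_add[OF A] linear_scale[OF A] blinfun.minus_left blinfun.scaleR_left
            blinfun.diff_right blinfun.add_right blinfun.scaleR_right algebra_simps
            power2_eq_square)
    qed
    moreover obtain f :: "'a dual" where "blinfun_apply f (y - A y') = norm (y - A y')"
      by (rule norming_functional)
    ultimately have "y = A y'" by simp
    then show ?thesis by (simp add: graph_S)
  qed
  then show "C = graph S" using sub by auto
qed

lemma quasidense_inverse: "quasidense S"
  unfolding quasidense_def
proof (intro allI)
  fix x x'
  define F where "F = (\<lambda>(s :: 'a, s'). ereal (1/2 * (norm (s - x))\<^sup>2 + 1/2 * (norm (s' - x'))\<^sup>2
               + blinfun_apply (s' - x') (s - x)))"
  have "(INF z\<in>graph S. F z) \<le> 0"
  proof (rule ereal_le_epsilon2)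
    fix e :: real assume "0 < e"
    \<comment> \<open>With \<open>s' = x' + h\<close> the difference \<open>s - x\<close> is \<open>Ah + c\<close> for \<open>c = A x' - x\<close>.\<close>
    then obtain h where h: "1/2 * (norm (A h + (A x' - x)))\<^sup>2 + 1/2 * (norm h)\<^sup>2
        + blinfun_apply h (A h + (A x' - x)) < e"
      using monotone_approximate_solution[OF A mono] by blast
    have "(INF z\<in>graph S. F z) \<le> F (A (x' + h), x' + h)"
      by (rule INF_lower) (simp add: graph_S)
    also have "\<dots> \<le> 0 + ereal e"
      using h by (simp add: F_def linear_add[OF A] algebra_simps)
    finally show "(INF z\<in>graph S. F z) \<le> 0 + ereal e" .
  qed
  then show "(INF (s, s')\<in>graph S. ereal (1/2 * (norm (s - x))\<^sup>2 + 1/2 * (norm (s' - x'))\<^sup>2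
               + blinfun_apply (s' - x') (s - x))) \<le> 0" by (simp add: F_def)
qed

lemma fitzpatrick_fun_lower:
  "ereal (blinfun_apply x' (A h) + blinfun_apply h x - blinfun_apply h (A h))
    \<le> fitzpatrick_fun S x x'"
  unfolding fitzpatrick_fun_def graph_S by (rule SUP_upper2[of "(A h, h)"]) auto

lemma fitzpatrick_fun_on_graph:
  "fitzpatrick_fun S (A h) h = ereal (blinfun_apply h (A h))"
proof (rule antisym)
  show "fitzpatrick_fun S (A h) h \<le> ereal (blinfun_apply h (A h))"
    unfolding fitzpatrick_fun_def graph_S
  proof (rule SUP_least, clarsimp)
    fix k
    show "blinfun_apply h (A k) + blinfun_apply k (A h) - blinfun_apply k (A k)
        \<le> blinfun_apply h (A h)"
      using mono[of "h - k"]
      by (simp add: linear_diff[OF A] blinfun.diff_left blinfun.diff_right)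
  qed
  show "ereal (blinfun_apply h (A h)) \<le> fitzpatrick_fun S (A h) h"
    using fitzpatrick_fun_lower[of h h "A h"] by simp
qed

lemma fitzpatrick_conj_lower:
  "ereal (blinfun_apply y' (A h) + blinfun_apply y'' h - blinfun_apply h (A h))
    \<le> fitzpatrick_conj S y' y''"
  unfolding fitzpatrick_conj_def
  by (rule SUP_upper2[of "(A h, h)"]) (auto simp: fitzpatrick_fun_on_graph)

lemma fitzpatrick_conj_canon:
  "fitzpatrick_conj S y' (canon (A y')) = ereal (blinfun_apply y' (A y'))"
proof (rule antisym)
  show "fitzpatrick_conj S y' (canon (A y')) \<le> ereal (blinfun_apply y' (A y'))"
    unfolding fitzpatrick_conj_def
  proof (rule SUP_least, clarify)
    fix x x'
    have "ereal (blinfun_apply y' x + blinfun_apply (canon (A y')) x') - fitzpatrick_fun S x x'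
      \<le> ereal (blinfun_apply y' x + blinfun_apply (canon (A y')) x')
        - ereal (blinfun_apply x' (A y') + blinfun_apply y' x - blinfun_apply y' (A y'))"
      by (intro ereal_minus_mono order_refl fitzpatrick_fun_lower)
    then show "ereal (blinfun_apply y' x + blinfun_apply (canon (A y')) x') - fitzpatrick_fun S x x'
      \<le> ereal (blinfun_apply y' (A y'))" by simp
  qed
  show "ereal (blinfun_apply y' (A y')) \<le> fitzpatrick_conj S y' (canon (A y'))"
    using fitzpatrick_conj_lower[of y' y' "canon (A y')"] by simp
qed

text \<open>Conversely, the supremum defining the conjugate, restricted to the graph points over
  \<open>y' + t h\<close>, already determines \<open>y''\<close> on every \<open>h\<close>.\<close>

lemma fitzpatrick_ext_inverse: "fitzpatrick_ext S y' = {canon (A y')}"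
proof -
  have "y'' = canon (A y')" if eq: "fitzpatrick_conj S y' y'' = ereal (blinfun_apply y'' y')" for y''
  proof (rule blinfun_eqI)
    fix h
    have "blinfun_apply y'' h - blinfun_apply h (A y') = 0"
    proof (rule linear_le_quadratic_imp_zero)
      fix t
      have "blinfun_apply y' (A (y' + t *\<^sub>R h)) + blinfun_apply y'' (y' + t *\<^sub>R h)
          - blinfun_apply (y' + t *\<^sub>R h) (A (y' + t *\<^sub>R h)) \<le> blinfun_apply y'' y'"
        using fitzpatrick_conj_lower[of y' "y' + t *\<^sub>R h" y''] eq by simp
      then show "t * (blinfun_apply y'' h - blinfun_apply h (A y')) \<le> t\<^sup>2 * blinfun_apply h (A h)"
        by (simp add: linear_add[OF A] linear_scale[OF A] blinfun.add_left blinfun.scaleR_left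
            blinfun.add_right blinfun.scaleR_right algebra_simps power2_eq_square)
    qed
    then show "blinfun_apply y'' h = blinfun_apply (canon (A y')) h" by simp
  qed
  then show ?thesis by (auto simp: fitzpatrick_ext_def fitzpatrick_conj_canon)
qed

end

theorem theorem8p7:
  fixes T :: "'a::banach dual \<Rightarrow> 'a bidual"
    and S :: "'a \<Rightarrow> 'a dual set"
  assumes nonzero: "\<exists>x::'a. x \<noteq> 0"
    and linear: "linear T"
    and monotone: "monotone_map T"
    and range: "range T \<subseteq> range canon"
    and S: "\<And>x x'. x' \<in> S x \<longleftrightarrow> canon x = T x'"
  shows "maximally_monotone S \<and> quasidense S
         \<and> graph (fitzpatrick_ext S) = graph (\<lambda>y'. {T y'})"
proof -
  define A where "A = (\<lambda>x'. inv canon (T x'))"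
  have canon_A: "canon (A x') = T x'" for x'
    unfolding A_def using range by (intro f_inv_into_f) blast
  have A: "linear A"
  proof (rule linearI; rule injD[OF inj_canon])
    show "canon (A (h + k)) = canon (A h + A k)" for h k
      by (simp add: canon_A linear_add[OF linear] linear_add[OF linear_canon])
    show "canon (A (t *\<^sub>R h)) = canon (t *\<^sub>R A h)" for t h
      by (simp add: canon_A linear_scale[OF linear] linear_scale[OF linear_canon])
  qed
  have mono: "0 \<le> blinfun_apply h (A h)" for h
    using monotone unfolding monotone_map_def by (metis canon_A canon_apply)
  have S_A: "x' \<in> S x \<longleftrightarrow> x = A x'" for x x'
    by (simp add: S inj_eq[OF inj_canon] flip: canon_A)
  show ?thesis
    using maximally_monotone_inverse[OF A mono S_A] quasidense_inverse[OF A mono S_A]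
      fitzpatrick_ext_inverse[OF A mono S_A] by (simp add: graph_def canon_A)
qed

end
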